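(* Let $\mathcal{A}$ be a compact irreducible family of real $d\times d$ matrices. Then for each admissible $\tau\in(0,1)$ and for every contractive norm $\|\cdot\|_\tau$ of the family $e^{\tau\mathcal{A}}$, after a multiplication of this norm by a positive constant, we have $$H(\mathcal{A})\,\|x\|_\tau\ \le\ \|x\|\ \le\ \|x\|_\tau,\qquad x\in\mathbb{R}^d,$$ where $\|\cdot\|$ is the Euclidean norm.
   Context: A family of matrices is irreducible if its elements share no common invariant subspace other than $\{0\}$ and $\mathbb{R}^d$. $e^{t\mathcal{A}}=\{e^{tA}:A\in\mathcal{A}\}$. A norm $\|\cdot\|_c$ on $\mathbb{R}^d$ is contractive for a family $\mathcal{B}$ if the induced operator norm satisfies $\|B\|_c\le1$ for all $B\in\mathcal{B}$. For a compact family $\mathcal{B}$ let $\mathcal{B}^k$ be the set of products of $k$ matrices of $\mathcal{B}$ ($\mathcal{B}^0=\{I\}$), $\mathbf{O}_{\mathcal{B}}(x)=\mathrm{co}\{\pm\Pi_kx:\Pi_k\in\mathcal{B}^k,\ k=0,\dots,d-1\}$, and $h(\mathcal{B})=\max\{r\ge0: B(0,r)\subset\mathbf{O}_{\mathcal{B}}(x)\ \text{for all } x\in\mathbb{R}^d,\ \|x\|=1\}$, where $B(0,r)$ is the Euclidean ball. $H(\mathcal{A})$ is the minimum of $h(e^{t\mathcal{A}})$ over the admissible $t\in[1,2]$. Admissible numbers. Fix an arbitrarily small $\delta>0$. For a matrix $A$ with spectrum $\mathrm{sp}(A)$, let $\mathcal{T}_0(A)$ be the intersection with $[0,2]$ of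 the union of the sets $\{2\pi n/|\mathrm{Im}(\lambda_i-\lambda_j)| : \lambda_i,\lambda_j\in\mathrm{sp}(A),\ \mathrm{Im}\lambda_i\ne\mathrm{Im}\lambda_j,\ n\in\mathbb{N}\}$ and $\{\pi n/|\mathrm{Im}\lambda_i| : \lambda_i\in\mathrm{sp}(A)\setminus\mathbb{R},\ n\in\mathbb{N}\}$. Let $\mathcal{T}_0(\delta,A)$ be some (fixed) open subset of $[0,2]$ of measure $\delta/2$ containing $\mathcal{T}_0(A)$, and $\mathcal{T}(\delta,A)=\bigcup_{k\ge0}2^{-k}\mathcal{T}_0(\delta,A)$. Fix a finite irreducible subset $\mathcal{A}_f\subset\mathcal{A}$ (with $\mathcal{A}_f=\mathcal{A}$ if $\mathcal{A}$ is finite) and put $\mathcal{T}(\delta,\mathcal{A})=\bigcup_{A\in\mathcal{A}_f}\mathcal{T}(\delta,A)$. A number $\tau\in(0,2]$ is admissible for $\mathcal{A}$ if $\tau\notin\mathcal{T}(\delta,\mathcal{A})$. All these choices are fixed once for the given $\mathcal{A}$. *)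

theory Defs
  imports "HOL-Analysis.Analysis"
begin

(* On square matrices the type class operations * and ^ act entrywise, so powers and
   the exponential are built from the matrix product ** instead. *)
primrec mat_power :: "real^'n^'n \<Rightarrow> nat \<Rightarrow> real^'n^'n" where
  "mat_power A 0 = mat 1"
| "mat_power A (Suc k) = A ** mat_power A k"

definition mat_exp :: "real^'n^'n \<Rightarrow> real^'n^'n" where
  "mat_exp A = (\<Sum>k. (1 / fact k) *\<^sub>R mat_power A k)"

definition exp_family :: "real \<Rightarrow> (real^'n^'n) set \<Rightarrow> (real^'n^'n) set" where
  "exp_family t \<A> = (\<lambda>A. mat_exp (t *\<^sub>R A)) ` \<A>"

definition irreducible_family :: "(real^'n^'n) set \<Rightarrow> bool" where
  "irreducible_family \<A> \<longleftrightarrow>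
     (\<forall>V. subspace V \<and> (\<forall>A\<in>\<A>. \<forall>v\<in>V. A *v v \<in> V) \<longrightarrow> V = {0} \<or> V = UNIV)"

definition is_norm :: "(real^'n \<Rightarrow> real) \<Rightarrow> bool" where
  "is_norm N \<longleftrightarrow>
     (\<forall>x. 0 \<le> N x) \<and> (\<forall>x. N x = 0 \<longleftrightarrow> x = 0) \<and>
     (\<forall>a x. N (a *\<^sub>R x) = \<bar>a\<bar> * N x) \<and> (\<forall>x y. N (x + y) \<le> N x + N y)"

(* Same shape as onorm, with N in place of the Euclidean norm (the quotient at 0 is 0). *)
definition induced_norm :: "(real^'n \<Rightarrow> real) \<Rightarrow> real^'n^'n \<Rightarrow> real" where
  "induced_norm N B = (SUP x. N (B *v x) / N x)"

definition contractive :: "(real^'n \<Rightarrow> real) \<Rightarrow> (real^'n^'n) set \<Rightarrow> bool" where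
  "contractive N \<B> \<longleftrightarrow> (\<forall>B\<in>\<B>. induced_norm N B \<le> 1)"

primrec mat_prods :: "(real^'n^'n) set \<Rightarrow> nat \<Rightarrow> (real^'n^'n) set" where
  "mat_prods \<B> 0 = {mat 1}"
| "mat_prods \<B> (Suc k) = {B ** P | B P. B \<in> \<B> \<and> P \<in> mat_prods \<B> k}"

definition orbit_hull :: "(real^'n^'n) set \<Rightarrow> real^'n \<Rightarrow> (real^'n) set" where
  "orbit_hull \<B> x = convex hull (\<Union>k<CARD('n). \<Union>P\<in>mat_prods \<B> k. {P *v x, - (P *v x)})"

definition h_const :: "(real^'n^'n) set \<Rightarrow> real" where
  "h_const \<B> = (GREATEST r. 0 \<le> r \<and> (\<forall>x. norm x = 1 \<longrightarrow> cball 0 r \<subseteq> orbit_hull \<B> x))"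

definition spectrum :: "real^'n^'n \<Rightarrow> complex set" where
  "spectrum A =
     {z. \<exists>v. v \<noteq> 0 \<and> (\<chi> i j. complex_of_real (A $ i $ j)) *v v = z *s v}"

definition T_zero :: "real^'n^'n \<Rightarrow> real set" where
  "T_zero A = {0..2} \<inter>
     ({2 * pi * real n / \<bar>Im (z - w)\<bar> | n z w.
         1 \<le> n \<and> z \<in> spectrum A \<and> w \<in> spectrum A \<and> Im z \<noteq> Im w}
      \<union> {pi * real n / \<bar>Im z\<bar> | n z. 1 \<le> n \<and> z \<in> spectrum A - \<real>})"

(* Openness is relative to [0,2], since T_zero A may contain the endpoint 2. *)
definition is_T_zero_cover :: "real \<Rightarrow> real^'n^'n \<Rightarrow> real set \<Rightarrow> bool" where
  "is_T_zero_cover \<delta> A U \<longleftrightarrow>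
     openin (top_of_set {0..2}) U \<and> measure lebesgue U = \<delta> / 2 \<and> T_zero A \<subseteq> U"

(* T0 A is the chosen cover of T_zero A, for A in the chosen finite subfamily. *)
definition T_family :: "(real^'n^'n) set \<Rightarrow> (real^'n^'n \<Rightarrow> real set) \<Rightarrow> real set" where
  "T_family \<A>f T0 = (\<Union>A\<in>\<A>f. \<Union>k::nat. (\<lambda>t. t / 2 ^ k) ` T0 A)"

definition admissible :: "(real^'n^'n) set \<Rightarrow> (real^'n^'n \<Rightarrow> real set) \<Rightarrow> real set" where
  "admissible \<A>f T0 = {0<..2} - T_family \<A>f T0"

(* The minimum over admissible t in [1,2], taken as an infimum: the set of these t need
   not be closed, because t = 1 alone is excluded when 2 lies in a cover T0 A. *)
definition H_const :: "(real^'n^'n) set \<Rightarrow> (real^'n^'n) set \<Rightarrow> (real^'n^'n \<Rightarrow> real set) \<Rightarrow> real" where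
  "H_const \<A> \<A>f T0 = (INF t\<in>admissible \<A>f T0 \<inter> {1..2}. h_const (exp_family t \<A>))"

lemma H_const_eq_minimum:
  assumes "t \<in> admissible \<A>f T0 \<inter> {1..2}"
    and "\<And>s. s \<in> admissible \<A>f T0 \<inter> {1..2} \<Longrightarrow> h_const (exp_family t \<A>) \<le> h_const (exp_family s \<A>)"
  shows "H_const \<A> \<A>f T0 = h_const (exp_family t \<A>)"
  unfolding H_const_def by (rule cInf_eq_minimum) (use assms in auto)

end

theory Submission
  imports Defs
begin

text \<open>
  Doubling an admissible \<open>\<tau> < 1\<close> finitely often gives an admissible \<open>t \<in> [1, 2]\<close>, and
  since \<open>e\<^sup>2\<^sup>X = (e\<^sup>X)\<^sup>2\<close>, every contractive norm \<open>N\<close> of the family at time \<open>\<tau>\<close> is contractive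
  at time \<open>t\<close>. Rescale \<open>N\<close> so that its minimum over the Euclidean unit sphere is \<open>1\<close>, attained
  at \<open>x\<^sub>0\<close>. The unit ball of \<open>N\<close> then contains the orbit hull of \<open>x\<^sub>0\<close>, hence the Euclidean ball
  of radius \<open>h\<close> at time \<open>t\<close>, and \<open>H \<le> h\<close>.
  The largest radius \<open>h\<close> exists because orbit hulls of the compact family \<open>e\<^sup>t\<^sup>\<A>\<close> are compact.
\<close>

section \<open>Matrix powers, the exponential series and its doubling formula\<close>

lemma bounded_bilinear_matrix_mul:
  "bounded_bilinear ((**) :: real^'n^'m \<Rightarrow> real^'k^'n \<Rightarrow> real^'k^'m)"
  unfolding bilinear_conv_bounded_bilinear[symmetric] bilinear_def
  by (intro conjI allI linearI)
     (simp_all add: matrix_matrix_mult_def vec_eq_iff sum.distrib sum_distrib_left distrib_left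
       distrib_right mult_ac)

lemma continuous_on_matrix_mul [continuous_intros]:
  fixes f :: "'a::topological_space \<Rightarrow> real^'n^'m" and g :: "'a \<Rightarrow> real^'k^'n"
  assumes "continuous_on S f" "continuous_on S g"
  shows "continuous_on S (\<lambda>x. f x ** g x)"
  using bounded_bilinear.continuous_on[OF bounded_bilinear_matrix_mul assms] .

lemma scaleR_matrix_mul_left: "(c *\<^sub>R A) ** B = c *\<^sub>R (A ** B)" for A :: "real^'n^'m"
  by (rule bounded_bilinear.scaleR_left[OF bounded_bilinear_matrix_mul])

lemma scaleR_matrix_mul_right: "A ** (c *\<^sub>R B) = c *\<^sub>R (A ** B)" for A :: "real^'n^'m"
  by (rule bounded_bilinear.scaleR_right[OF bounded_bilinear_matrix_mul])

lemma mat_power_add: "mat_power A (m + n) = mat_power A m ** mat_power A n"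
  by (induction m) (simp_all add: matrix_mul_assoc)

lemma mat_power_scaleR: "mat_power (c *\<^sub>R A) n = c ^ n *\<^sub>R mat_power A n"
  by (induction n) (simp_all add: scaleR_matrix_mul_left scaleR_matrix_mul_right)

text \<open>Iterating the bound \<open>K\<close> of the bilinear product gives geometric growth; the
  factor \<open>norm (mat 1)\<close> covers the power 0. A single \<open>K\<close> serves all
  \<open>A\<close> and \<open>n\<close>, so the estimate is uniform on bounded sets of
  matrices.\<close>

lemma norm_mat_power_le:
  obtains K where "K \<ge> 0"
    "\<And>(A::real^'n^'n) n. norm (mat_power A n) \<le> norm (mat 1 :: real^'n^'n) * (K * norm A) ^ n"
proof -
  obtain K where K: "K \<ge> 0" "\<And>(A::real^'n^'n) (B::real^'n^'n). norm (A ** B) \<le> norm A * norm B * K"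
    using bounded_bilinear.nonneg_bounded[OF bounded_bilinear_matrix_mul] by blast
  have "norm (mat_power A n) \<le> norm (mat 1 :: real^'n^'n) * (K * norm A) ^ n" for A :: "real^'n^'n" and n
  proof (induction n)
    case (Suc n)
    have "norm (mat_power A (Suc n)) \<le> (K * norm A) * norm (mat_power A n)"
      using K(2)[of A "mat_power A n"] by (simp add: mult_ac)
    also have "\<dots> \<le> (K * norm A) * (norm (mat 1 :: real^'n^'n) * (K * norm A) ^ n)"
      using Suc K(1) by (intro mult_left_mono) auto
    finally show ?case by (simp add: mult_ac)
  qed simp
  with K(1) that show ?thesis by blast
qed

lemma summable_norm_mat_exp:
  "summable (\<lambda>k. norm ((1 / fact k) *\<^sub>R mat_power A k))"
proof -
  obtain K where K: "K \<ge> 0"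
    "\<And>(A::real^'a^'a) n. norm (mat_power A n) \<le> norm (mat 1 :: real^'a^'a) * (K * norm A) ^ n"
    by (rule norm_mat_power_le) blast
  have "summable (\<lambda>k. norm (mat 1 :: real^'a^'a) * (inverse (fact k) * (K * norm A) ^ k))"
    by (intro summable_mult summable_exp)
  then show ?thesis
    by (rule summable_comparison_test[rotated])
       (use K in \<open>auto intro!: exI[of _ 0] simp: field_simps\<close>)
qed

lemma sums_mat_exp: "(\<lambda>k. (1 / fact k) *\<^sub>R mat_power A k) sums mat_exp A"
  unfolding mat_exp_def
  by (rule summable_sums[OF summable_norm_cancel[OF summable_norm_mat_exp]])

text \<open>Passing to entries turns the matrix series into real series, to which the Cauchy product
  theorem applies; \<open>*\<close> on matrices is entrywise and would give the wrong
  product.\<close>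

lemma sums_mat_exp_entry:
  "(\<lambda>k. mat_power A k $ i $ j / fact k) sums (mat_exp A $ i $ j)"
proof -
  have "(\<lambda>k. ((1 / fact k) *\<^sub>R mat_power A k) $ i $ j) sums (mat_exp A $ i $ j)"
    by (rule bounded_linear.sums[OF bounded_linear_vec_nth
          bounded_linear.sums[OF bounded_linear_vec_nth sums_mat_exp]])
  then show ?thesis by simp
qed

lemma summable_abs_mat_exp_entry:
  "summable (\<lambda>k. \<bar>mat_power A k $ i $ j / fact k\<bar>)"
proof (rule summable_comparison_test[OF _ summable_norm_mat_exp[of A]], intro exI[of _ 0] allI impI)
  fix k
  have "norm (((1 / fact k) *\<^sub>R mat_power A k) $ i $ j) \<le> norm ((1 / fact k) *\<^sub>R mat_power A k)"
    by (rule order_trans[OF Finite_Cartesian_Product.norm_nth_le Finite_Cartesian_Product.norm_nth_le])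
  then show "norm \<bar>mat_power A k $ i $ j / fact k\<bar> \<le> norm ((1 / fact k) *\<^sub>R mat_power A k)"
    by simp
qed

text \<open>Each entry of the product on the right is a finite sum of Cauchy products. The terms of
  order \<open>k\<close> all carry the same power of \<open>A\<close>, and their binomial weights
  add up to \<open>2 ^ k\<close>, which is the factor that scaling by 2 puts on that power.\<close>

lemma mat_exp_double: "mat_exp (2 *\<^sub>R A) = mat_exp A ** mat_exp A"
proof -
  have "mat_exp (2 *\<^sub>R A) $ i $ j = (mat_exp A ** mat_exp A) $ i $ j" for i j
  proof -
    let ?a = "\<lambda>i j k. mat_power A k $ i $ j / fact k"
    have "(\<lambda>k. \<Sum>m\<le>k. ?a i l m * ?a l j (k - m)) sums (mat_exp A $ i $ l * mat_exp A $ l $ j)" for l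
      using Cauchy_product_sums[of "?a i l" "?a l j"] summable_abs_mat_exp_entry[of A]
      by (simp add: sums_unique[OF sums_mat_exp_entry, symmetric])
    then have "(\<lambda>k. \<Sum>l\<in>UNIV. \<Sum>m\<le>k. ?a i l m * ?a l j (k - m)) sums
        (\<Sum>l\<in>UNIV. mat_exp A $ i $ l * mat_exp A $ l $ j)"
      by (intro sums_sum)
    moreover have "(\<Sum>l\<in>UNIV. \<Sum>m\<le>k. ?a i l m * ?a l j (k - m)) =
        mat_power (2 *\<^sub>R A) k $ i $ j / fact k" for k
    proof -
      have "(\<Sum>l\<in>UNIV. \<Sum>m\<le>k. ?a i l m * ?a l j (k - m)) =
          (\<Sum>m\<le>k. \<Sum>l\<in>UNIV. ?a i l m * ?a l j (k - m))"
        \<comment> \<open>With the sum over \<open>l\<close> inside, it becomes an entry of a matrix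
          product, so that \<open>mat_power_add\<close> can merge the two powers.\<close>
        by (rule sum.swap)
      also have "\<dots> = (\<Sum>m\<le>k. of_nat (k choose m) * (mat_power A k $ i $ j / fact k))"
      proof (rule sum.cong[OF refl])
        fix m assume "m \<in> {..k}"
        then have m: "m \<le> k" by simp
        have "(\<Sum>l\<in>UNIV. ?a i l m * ?a l j (k - m)) =
            (mat_power A m ** mat_power A (k - m)) $ i $ j / (fact m * fact (k - m))"
          by (simp add: matrix_matrix_mult_def sum_divide_distrib)
        also have "\<dots> = of_nat (k choose m) * (mat_power A k $ i $ j / fact k)"
          using m by (simp add: mat_power_add[symmetric] binomial_fact)
        finally show "(\<Sum>l\<in>UNIV. ?a i l m * ?a l j (k - m)) = \<dots>" .
      qed
      also have "\<dots> = of_nat (\<Sum>m\<le>k. k choose m) * (mat_power A k $ i $ j / fact k)"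
        by (simp only: of_nat_sum sum_distrib_right)
      also have "\<dots> = mat_power (2 *\<^sub>R A) k $ i $ j / fact k"
        by (simp add: choose_row_sum mat_power_scaleR)
      finally show ?thesis .
    qed
    ultimately have "(\<lambda>k. mat_power (2 *\<^sub>R A) k $ i $ j / fact k) sums
        (\<Sum>l\<in>UNIV. mat_exp A $ i $ l * mat_exp A $ l $ j)"
      by simp
    from sums_unique2[OF sums_mat_exp_entry this] show ?thesis
      by (simp add: matrix_matrix_mult_def)
  qed
  then show ?thesis by (simp add: vec_eq_iff)
qed

section \<open>Continuity of the exponential; compactness of the families and orbit hulls\<close>

lemma continuous_on_mat_power: "continuous_on S (\<lambda>A. mat_power A k)"
  by (induction k) (auto intro!: continuous_intros)

text \<open>On a bounded set the exponential series has a summable majorant independent of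
  \<open>A\<close>, so the polynomial partial sums converge uniformly.\<close>

lemma continuous_on_mat_exp:
  assumes "bounded S"
  shows "continuous_on S mat_exp"
proof -
  obtain r where r: "\<And>A. A \<in> S \<Longrightarrow> norm A \<le> r" using assms by (auto simp: bounded_iff)
  obtain K where K: "K \<ge> 0"
    "\<And>(A::real^'a^'a) n. norm (mat_power A n) \<le> norm (mat 1 :: real^'a^'a) * (K * norm A) ^ n"
    by (rule norm_mat_power_le) blast
  have "norm ((1 / fact n) *\<^sub>R mat_power A n) \<le>
      norm (mat 1 :: real^'a^'a) * (inverse (fact n) * (K * r) ^ n)" if "A \<in> S" for A n
  proof -
    have "norm (mat_power A n) \<le> norm (mat 1 :: real^'a^'a) * (K * norm A) ^ n" by (rule K)
    also have "\<dots> \<le> norm (mat 1 :: real^'a^'a) * (K * r) ^ n"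
      using K(1) r[OF that] by (intro mult_left_mono power_mono) auto
    finally show ?thesis by (simp add: field_simps)
  qed
  then have "uniform_limit S (\<lambda>n A. \<Sum>k<n. (1 / fact k) *\<^sub>R mat_power A k)
      (\<lambda>A. \<Sum>k. (1 / fact k) *\<^sub>R mat_power A k) sequentially"
    by (rule Weierstrass_m_test) (assumption, intro summable_mult summable_exp)
  then have "continuous_on S (\<lambda>A. \<Sum>k. (1 / fact k) *\<^sub>R mat_power A k)"
    by (rule uniform_limit_theorem[rotated])
       (auto intro!: always_eventually continuous_intros continuous_on_mat_power)
  then show ?thesis by (simp add: mat_exp_def[abs_def])
qed

lemma compact_exp_family:
  assumes "compact \<A>"
  shows "compact (exp_family t \<A>)"
proof -
  have "compact ((*\<^sub>R) t ` \<A>)" using assms by (rule compact_scaling)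
  then have "compact (mat_exp ` (*\<^sub>R) t ` \<A>)"
    using compact_continuous_image[OF continuous_on_mat_exp[OF compact_imp_bounded]] by blast
  then show ?thesis by (simp add: exp_family_def image_image)
qed

lemma compact_mat_prods:
  assumes "compact \<B>"
  shows "compact (mat_prods \<B> k)"
proof (induction k)
  case (Suc k)
  have "compact ((\<lambda>p. fst p ** snd p) ` (\<B> \<times> mat_prods \<B> k))"
    using assms Suc by (intro compact_continuous_image compact_Times continuous_intros)
  also have "(\<lambda>p. fst p ** snd p) ` (\<B> \<times> mat_prods \<B> k) = mat_prods \<B> (Suc k)"
    by force
  finally show ?case .
qed simp

text \<open>The generators form a finite union of continuous images of compact sets, and in finite
  dimension the convex hull of a compact set is compact.\<close>

lemma compact_orbit_hull:
  assumes "compact \<B>"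
  shows "compact (orbit_hull \<B> x)"
proof -
  have "compact ((\<lambda>P. P *v x) ` mat_prods \<B> k \<union> (\<lambda>P. - (P *v x)) ` mat_prods \<B> k)" for k
    using compact_mat_prods[OF assms]
    by (intro compact_Un compact_continuous_image continuous_intros
        linear_continuous_on linear_conv_bounded_linear[THEN iffD1] linearI)
       (auto simp: algebra_simps scaleR_matrix_vector_assoc[symmetric])
  moreover have "(\<Union>P\<in>mat_prods \<B> k. {P *v x, - (P *v x)}) =
      (\<lambda>P. P *v x) ` mat_prods \<B> k \<union> (\<lambda>P. - (P *v x)) ` mat_prods \<B> k" for k
    by auto
  ultimately show ?thesis
    unfolding orbit_hull_def
    by (simp only:) (rule compact_convex_hull[OF compact_UN[OF finite_lessThan]])
qed

section \<open>Existence of the largest inscribed radius\<close>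

lemma zero_in_orbit_hull: "0 \<in> orbit_hull \<B> x"
proof -
  let ?S = "\<Union>k<CARD('a). \<Union>P\<in>mat_prods \<B> k. {P *v x, - (P *v x)}"
  have "0 < CARD('a)" by simp
  \<comment> \<open>The empty product \<open>k = 0\<close> contributes \<open>x\<close> and
    \<open>- x\<close>, whose midpoint is 0.\<close>
  then have "x \<in> ?S" "- x \<in> ?S" by (force intro: bexI[of _ 0])+
  then have "(1/2) *\<^sub>R x + (1/2) *\<^sub>R (- x) \<in> convex hull ?S"
    by (intro convexD[OF convex_convex_hull] hull_inc) simp_all
  then show ?thesis by (simp add: orbit_hull_def)
qed

text \<open>\<open>GREATEST\<close> says something about \<open>h_const\<close> only if a largest
  radius exists. The qualifying radii include 0 and are bounded, and their supremum qualifies too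
  because orbit hulls are closed.\<close>

lemma
  assumes "compact \<B>"
  shows h_const_nonneg: "0 \<le> h_const \<B>"
    and cball_h_const_subset: "norm x = 1 \<Longrightarrow> cball 0 (h_const \<B>) \<subseteq> orbit_hull \<B> x"
proof -
  define P where "P r \<longleftrightarrow> 0 \<le> r \<and> (\<forall>x. norm x = 1 \<longrightarrow> cball 0 r \<subseteq> orbit_hull \<B> x)" for r
  have P0: "P 0" by (simp add: P_def zero_in_orbit_hull)
  obtain e :: "real^'a" where e: "norm e = 1" by (rule vector_choose_size[of 1]) auto
  obtain M where M: "\<And>y. y \<in> orbit_hull \<B> e \<Longrightarrow> norm y \<le> M"
    using compact_imp_bounded[OF compact_orbit_hull[OF assms, of e]] by (auto simp: bounded_iff)
  have "r \<le> M" if "P r" for r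
  proof -
    \<comment> \<open>One boundary point of the ball inside one bounded hull already limits
      \<open>r\<close>.\<close>
    have "r *\<^sub>R e \<in> cball 0 r" using that e by (simp add: P_def)
    then have "r *\<^sub>R e \<in> orbit_hull \<B> e" using that e unfolding P_def by blast
    from M[OF this] show ?thesis using that e by (simp add: P_def)
  qed
  then have bdd: "bdd_above (Collect P)" by (intro bdd_aboveI[of _ M]) simp
  define s where "s = Sup (Collect P)"
  have ub: "r \<le> s" if "P r" for r
    unfolding s_def using that bdd by (intro cSup_upper) auto
  have "P s"
  \<comment> \<open>The case \<open>s = 0\<close> stands apart because \<open>ball 0 0\<close> is
    empty, so its closure is not \<open>cball 0 0\<close>.\<close>
  proof (cases "s = 0")
    case False
    with ub[OF P0] have "s > 0" by simp
    have "cball 0 s \<subseteq> orbit_hull \<B> x" if x: "norm x = 1" for x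
    proof -
      have "ball 0 s \<subseteq> orbit_hull \<B> x"
      proof
        fix y :: "real^'a" assume "y \<in> ball 0 s"
        then have "norm y < Sup (Collect P)" by (simp add: s_def)
        then obtain r where "P r" "norm y < r"
          using less_cSup_iff[OF _ bdd, of "norm y"] P0 by auto
        then have "y \<in> cball 0 r" "cball 0 r \<subseteq> orbit_hull \<B> x"
          using x by (simp_all add: P_def)
        then show "y \<in> orbit_hull \<B> x" by blast
      qed
      then have "closure (ball 0 s) \<subseteq> orbit_hull \<B> x"
        by (intro closure_minimal compact_imp_closed compact_orbit_hull assms)
      then show ?thesis using \<open>s > 0\<close> by simp
    qed
    then show ?thesis using \<open>s > 0\<close> by (simp add: P_def)
  qed (use P0 in simp)
  then have "Greatest P = s" using ub by (intro Greatest_equality)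
  then have "P (h_const \<B>)" using \<open>P s\<close> by (simp add: h_const_def P_def[abs_def])
  then show "0 \<le> h_const \<B>" "norm x = 1 \<Longrightarrow> cball 0 (h_const \<B>) \<subseteq> orbit_hull \<B> x"
    by (simp_all add: P_def)
qed

section \<open>Norms on the space: comparison with the Euclidean norm, and contractivity\<close>

context
  fixes N :: "real^'n \<Rightarrow> real"
  assumes N: "is_norm N"
begin

lemma
  shows is_norm_nonneg: "0 \<le> N x"
    and is_norm_eq_0_iff: "N x = 0 \<longleftrightarrow> x = 0"
    and is_norm_scaleR: "N (a *\<^sub>R x) = \<bar>a\<bar> * N x"
    and is_norm_triangle: "N (x + y) \<le> N x + N y"
  using N by (auto simp: is_norm_def)

lemma is_norm_uminus: "N (- x) = N x"
  using is_norm_scaleR[of "-1" x] by simp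

text \<open>This serves continuity: a finite convex function on an open set in finite dimension is
  continuous.\<close>

lemma is_norm_convex_on: "convex_on UNIV N"
proof (rule convex_onI)
  fix t :: real and x y :: "real^'n"
  assume "0 < t" "t < 1"
  then show "N ((1 - t) *\<^sub>R x + t *\<^sub>R y) \<le> (1 - t) * N x + t * N y"
    using is_norm_triangle[of "(1 - t) *\<^sub>R x" "t *\<^sub>R y"] by (simp add: is_norm_scaleR)
qed simp

lemma is_norm_continuous_on: "continuous_on S N"
  using convex_on_continuous[OF open_UNIV is_norm_convex_on] continuous_on_subset by blast

text \<open>Continuity on the compact sphere gives the minimum, and homogeneity extends the bound to
  all \<open>x\<close>. The minimizer is the point whose orbit hull the theorem uses.\<close>

lemma is_norm_unit_sphere_min:
  obtains x\<^sub>0 where "norm x\<^sub>0 = 1" "N x\<^sub>0 > 0" "\<And>x. N x\<^sub>0 * norm x \<le> N x"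
proof -
  have "sphere 0 1 \<noteq> ({} :: (real^'n) set)" by simp
  then obtain x\<^sub>0 where x\<^sub>0: "x\<^sub>0 \<in> sphere 0 1" "\<And>y. y \<in> sphere 0 1 \<Longrightarrow> N x\<^sub>0 \<le> N y"
    using continuous_attains_inf[OF compact_sphere _ is_norm_continuous_on] by blast
  have "N x\<^sub>0 * norm x \<le> N x" for x
  proof (cases "x = 0")
    case False
    then have "N x\<^sub>0 \<le> N ((1 / norm x) *\<^sub>R x)" by (intro x\<^sub>0) simp
    then show ?thesis using False by (simp add: is_norm_scaleR field_simps)
  qed (use is_norm_nonneg in simp)
  moreover have "norm x\<^sub>0 = 1" "N x\<^sub>0 > 0"
    using x\<^sub>0(1) is_norm_nonneg[of x\<^sub>0] is_norm_eq_0_iff[of x\<^sub>0] by (auto simp: less_le)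
  ultimately show ?thesis using that by blast
qed

lemma is_norm_le_norm:
  obtains K where "K \<ge> 0" "\<And>x. N x \<le> K * norm x"
proof -
  have "sphere 0 1 \<noteq> ({} :: (real^'n) set)" by simp
  then obtain z where z: "\<And>y. y \<in> sphere 0 1 \<Longrightarrow> N y \<le> N z"
    using continuous_attains_sup[OF compact_sphere _ is_norm_continuous_on] by blast
  have "N x \<le> N z * norm x" for x
  proof (cases "x = 0")
    case False
    then have "N ((1 / norm x) *\<^sub>R x) \<le> N z" by (intro z) simp
    then show ?thesis using False by (simp add: is_norm_scaleR field_simps)
  qed (use is_norm_eq_0_iff[of 0] in simp)
  then show ?thesis using that is_norm_nonneg by blast
qed

text \<open>A real \<open>SUP\<close> controls the individual quotients only when they are bounded
  above.\<close>

lemma induced_norm_bdd_above: "bdd_above (range (\<lambda>x. N (B *v x) / N x))"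
proof -
  obtain x\<^sub>0 where x\<^sub>0: "N x\<^sub>0 > 0" "\<And>x. N x\<^sub>0 * norm x \<le> N x"
    by (rule is_norm_unit_sphere_min) blast
  obtain K where K: "K \<ge> 0" "\<And>x. N x \<le> K * norm x" by (rule is_norm_le_norm) blast
  \<comment> \<open>Equivalence of norms: \<open>K\<close> bounds \<open>N\<close> by the Euclidean
    norm, \<open>onorm\<close> handles \<open>B\<close>, and \<open>1 / N x\<^sub>0\<close> leads
    back to \<open>N\<close>.\<close>
  let ?C = "K * onorm ((*v) B) / N x\<^sub>0"
  have C: "?C \<ge> 0" using K x\<^sub>0 by (simp add: onorm_pos_le)
  have "N (B *v x) / N x \<le> ?C" for x
  proof (cases "x = 0")
    case False
    then have "N x > 0" using is_norm_nonneg[of x] is_norm_eq_0_iff[of x] by simp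
    have "N (B *v x) \<le> K * (onorm ((*v) B) * norm x)"
      using K(2)[of "B *v x"] mult_left_mono[OF onorm[of "(*v) B" x] K(1)] by simp
    also have "\<dots> = ?C * (N x\<^sub>0 * norm x)" using x\<^sub>0(1) by simp
    also have "\<dots> \<le> ?C * N x" using C x\<^sub>0(2) by (intro mult_left_mono) auto
    finally show ?thesis using \<open>N x > 0\<close> by (simp add: pos_divide_le_eq)
  qed (use is_norm_eq_0_iff C in simp)
  then show ?thesis by (rule bdd_aboveI2)
qed

lemma induced_norm_le_one_iff: "induced_norm N B \<le> 1 \<longleftrightarrow> (\<forall>x. N (B *v x) \<le> N x)"
proof -
  have "induced_norm N B \<le> 1 \<longleftrightarrow> (\<forall>x. N (B *v x) / N x \<le> 1)"
    unfolding induced_norm_def by (subst cSUP_le_iff[OF _ induced_norm_bdd_above]) auto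
  \<comment> \<open>At \<open>x = 0\<close> the quotient is \<open>0 / 0 = 0\<close>, and both
    inequalities hold.\<close>
  moreover have "N (B *v x) / N x \<le> 1 \<longleftrightarrow> N (B *v x) \<le> N x" for x
    using is_norm_nonneg[of x] is_norm_eq_0_iff[of x] is_norm_eq_0_iff[of "B *v x"]
    by (cases "x = 0") (simp_all add: divide_le_eq_1)
  ultimately show ?thesis by simp
qed

lemma contractive_iff: "contractive N \<B> \<longleftrightarrow> (\<forall>B\<in>\<B>. \<forall>x. N (B *v x) \<le> N x)"
  by (simp add: contractive_def induced_norm_le_one_iff)

lemma contractive_exp_family_double:
  assumes "contractive N (exp_family t \<A>)"
  shows "contractive N (exp_family (2 * t) \<A>)"
proof -
  have "N (mat_exp ((2 * t) *\<^sub>R A) *v x) \<le> N x" if "A \<in> \<A>" for A x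
  proof -
    have *: "N (mat_exp (t *\<^sub>R A) *v y) \<le> N y" for y
      using assms that by (auto simp: contractive_iff exp_family_def)
    have "mat_exp ((2 * t) *\<^sub>R A) *v x = mat_exp (t *\<^sub>R A) *v (mat_exp (t *\<^sub>R A) *v x)"
      using mat_exp_double[of "t *\<^sub>R A"] by (simp add: matrix_vector_mul_assoc)
    then show ?thesis using *[of x] *[of "mat_exp (t *\<^sub>R A) *v x"] by simp
  qed
  then show ?thesis by (auto simp: contractive_iff exp_family_def)
qed

lemma contractive_exp_family_power2:
  assumes "contractive N (exp_family t \<A>)"
  shows "contractive N (exp_family (2 ^ k * t) \<A>)"
  by (induction k) (use assms contractive_exp_family_double in \<open>auto simp: mult.assoc\<close>)

lemma contractive_mat_prods:
  assumes "contractive N \<B>" "P \<in> mat_prods \<B> k"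
  shows "N (P *v x) \<le> N x"
  using assms(2)
proof (induction k arbitrary: P)
  case (Suc k)
  then obtain B Q where "P = B ** Q" "B \<in> \<B>" "Q \<in> mat_prods \<B> k" by auto
  with Suc.IH[of Q] assms(1) show ?case
    by (fastforce simp: contractive_iff matrix_vector_mul_assoc[symmetric] intro: order_trans)
qed simp

text \<open>The sublevel set of \<open>N\<close> at height \<open>N x\<close> is convex and, by
  contractivity and symmetry of \<open>N\<close>, contains every generator of the hull.\<close>

lemma is_norm_le_orbit_hull:
  assumes "contractive N \<B>" "y \<in> orbit_hull \<B> x"
  shows "N y \<le> N x"
proof -
  have "convex {y. N y \<le> N x}"
  proof (rule convexI)
    fix y z and u v :: real
    assume "y \<in> {y. N y \<le> N x}" "z \<in> {y. N y \<le> N x}" "0 \<le> u" "0 \<le> v" "u + v = 1"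
    then have "N (u *\<^sub>R y) + N (v *\<^sub>R z) \<le> N x"
      by (simp add: is_norm_scaleR convex_bound_le)
    then show "u *\<^sub>R y + v *\<^sub>R z \<in> {y. N y \<le> N x}"
      using is_norm_triangle[of "u *\<^sub>R y" "v *\<^sub>R z"] by simp
  qed
  then have "orbit_hull \<B> x \<subseteq> {y. N y \<le> N x}"
    unfolding orbit_hull_def
    by (intro hull_minimal) (auto simp: is_norm_uminus intro: contractive_mat_prods[OF assms(1)])
  then show ?thesis using assms(2) by auto
qed

end

section \<open>Dyadic rescaling of admissible times\<close>

text \<open>\<open>T_family\<close> is closed under halving by construction, so its complement is
  closed under doubling.\<close>

lemma admissible_power2:
  assumes "\<tau> \<in> admissible \<A>f T0" "2 ^ k * \<tau> \<le> 2"
  shows "2 ^ k * \<tau> \<in> admissible \<A>f T0"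
proof -
  have "2 ^ k * \<tau> \<notin> T_family \<A>f T0"
  proof
    assume "2 ^ k * \<tau> \<in> T_family \<A>f T0"
    then obtain A m s where s: "A \<in> \<A>f" "s \<in> T0 A" "2 ^ k * \<tau> = s / 2 ^ m"
      by (auto simp: T_family_def)
    then have "\<tau> = s / 2 ^ (k + m)" by (simp add: power_add field_simps)
    with s have "\<tau> \<in> T_family \<A>f T0" unfolding T_family_def by blast
    with assms(1) show False by (simp add: admissible_def)
  qed
  with assms show ?thesis by (auto simp: admissible_def)
qed

lemma ex_power2_mult_between:
  fixes \<tau> :: real
  assumes "0 < \<tau>" "\<tau> < 1"
  obtains k where "1 \<le> 2 ^ k * \<tau>" "2 ^ k * \<tau> \<le> 2"
proof -
  define k where "k = (LEAST k. 1 \<le> 2 ^ k * \<tau>)"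
  obtain n where "1 / \<tau> < 2 ^ n" using real_arch_pow[of 2 "1 / \<tau>"] by auto
  then have "1 \<le> 2 ^ n * \<tau>" using assms by (simp add: field_simps)
  then have k: "1 \<le> 2 ^ k * \<tau>" unfolding k_def by (rule LeastI)
  \<comment> \<open>\<open>k = 0\<close> would give \<open>1 \<le> \<tau>\<close>. Minimality of
    \<open>k\<close> then bounds \<open>2 ^ j * \<tau>\<close> by 1, and one doubling stays within
    2.\<close>
  with assms obtain j where j: "k = Suc j" by (cases k) auto
  then have "\<not> 1 \<le> 2 ^ j * \<tau>" using not_less_Least[of j "\<lambda>k. 1 \<le> 2 ^ k * \<tau>"] k_def by simp
  with k j that[of k] show ?thesis by simp
qed

theorem proposition2:
  fixes \<A> \<A>f :: "(real^'n^'n) set"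
    and T0 :: "real^'n^'n \<Rightarrow> real set"
    and N :: "real^'n \<Rightarrow> real"
    and \<delta> \<tau> :: real
  assumes "compact \<A>"
    and "irreducible_family \<A>"
    and "finite \<A>f" and "\<A>f \<subseteq> \<A>" and "irreducible_family \<A>f"
    and "finite \<A> \<Longrightarrow> \<A>f = \<A>"
    and "\<delta> > 0"
    and "\<And>A. A \<in> \<A>f \<Longrightarrow> is_T_zero_cover \<delta> A (T0 A)"
    and "\<tau> \<in> admissible \<A>f T0" and "0 < \<tau>" and "\<tau> < 1"
    and "is_norm N"
    and "contractive N (exp_family \<tau> \<A>)"
  shows "\<exists>c>0. \<forall>x. H_const \<A> \<A>f T0 * (c * N x) \<le> norm x \<and> norm x \<le> c * N x"
proof -
  obtain k where k: "1 \<le> 2 ^ k * \<tau>" "2 ^ k * \<tau> \<le> 2"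
    using ex_power2_mult_between[OF \<open>0 < \<tau>\<close> \<open>\<tau> < 1\<close>] by blast
  define \<B> where "\<B> = exp_family (2 ^ k * \<tau>) \<A>"
  have compact_\<B>: "compact \<B>" unfolding \<B>_def using \<open>compact \<A>\<close> by (rule compact_exp_family)
  have contr: "contractive N \<B>"
    unfolding \<B>_def by (rule contractive_exp_family_power2) fact+
  \<comment> \<open>\<open>H_const\<close> is an infimum of reals, which lies below each value once
    the values have a lower bound, here 0.\<close>
  have "bdd_below ((\<lambda>t. h_const (exp_family t \<A>)) ` (admissible \<A>f T0 \<inter> {1..2}))"
    using h_const_nonneg[OF compact_exp_family[OF \<open>compact \<A>\<close>]] by (rule bdd_belowI2)
  then have H_le: "H_const \<A> \<A>f T0 \<le> h_const \<B>"
    unfolding H_const_def \<B>_def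
    using admissible_power2[OF \<open>\<tau> \<in> admissible \<A>f T0\<close> k(2)] k by (intro cINF_lower) auto
  obtain x\<^sub>0 where x\<^sub>0: "norm x\<^sub>0 = 1" "N x\<^sub>0 > 0" "\<And>x. N x\<^sub>0 * norm x \<le> N x"
    using is_norm_unit_sphere_min[OF \<open>is_norm N\<close>] by blast
  have h: "h_const \<B> * N x \<le> N x\<^sub>0 * norm x" for x
  proof (cases "x = 0")
    case False
    \<comment> \<open>\<open>x\<close> is rescaled to Euclidean length \<open>h_const \<B>\<close>,
      hence lies in the orbit hull of \<open>x\<^sub>0\<close>, where \<open>N\<close> is at most
      \<open>N x\<^sub>0\<close>.\<close>
    have "(h_const \<B> / norm x) *\<^sub>R x \<in> cball 0 (h_const \<B>)"
      using False h_const_nonneg[OF compact_\<B>] by simp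
    then have "N ((h_const \<B> / norm x) *\<^sub>R x) \<le> N x\<^sub>0"
      using is_norm_le_orbit_hull[OF \<open>is_norm N\<close> contr] cball_h_const_subset[OF compact_\<B> x\<^sub>0(1)]
      by blast
    then show ?thesis
      using False h_const_nonneg[OF compact_\<B>]
      by (simp add: is_norm_scaleR[OF \<open>is_norm N\<close>] field_simps)
  qed (use is_norm_eq_0_iff[OF \<open>is_norm N\<close>, of 0] in simp)
  show ?thesis
  \<comment> \<open>This factor makes the minimum of the rescaled norm on the Euclidean sphere equal
    to 1; the upper bound on \<open>norm x\<close> is exactly that minimality.\<close>
  proof (intro exI[of _ "1 / N x\<^sub>0"] conjI allI)
    fix x
    have "H_const \<A> \<A>f T0 * N x \<le> N x\<^sub>0 * norm x"
      using mult_right_mono[OF H_le is_norm_nonneg[OF \<open>is_norm N\<close>, of x]] h[of x] by simp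
    then show "H_const \<A> \<A>f T0 * (1 / N x\<^sub>0 * N x) \<le> norm x"
      using x\<^sub>0(2) by (simp add: field_simps)
    show "norm x \<le> 1 / N x\<^sub>0 * N x" using x\<^sub>0(2,3) by (simp add: field_simps)
  qed (use x\<^sub>0(2) in simp)
qed

end
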